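(* Let $R$ be a uniquely $\sqrt{J}$-clean ring. Then every idempotent of $R$ is central.
   Context: Rings are associative with identity $1\neq 0$ (not necessarily commutative). $J(R)$ is the Jacobson radical of $R$, and $\sqrt{J(R)}=\{z\in R : z^n\in J(R)\text{ for some } n\ge 1\}$. A ring $R$ is uniquely $\sqrt{J}$-clean if every $a\in R$ can be written in exactly one way as $a=e+z$ with $e$ an idempotent of $R$ and $z\in\sqrt{J(R)}$. *)

theory Defs
  imports "HOL-Algebra.Ring" "HOL-Algebra.AbelCoset"
begin

definition idempotents :: "('a, 'b) ring_scheme \<Rightarrow> 'a set" where
  "idempotents R = {e \<in> carrier R. e \<otimes>\<^bsub>R\<^esub> e = e}"

definition left_ideal :: "'a set \<Rightarrow> ('a, 'b) ring_scheme \<Rightarrow> bool" where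
  "left_ideal I R \<longleftrightarrow>
     additive_subgroup I R \<and> (\<forall>r \<in> carrier R. \<forall>x \<in> I. r \<otimes>\<^bsub>R\<^esub> x \<in> I)"

definition maximal_left_ideal :: "'a set \<Rightarrow> ('a, 'b) ring_scheme \<Rightarrow> bool" where
  "maximal_left_ideal M R \<longleftrightarrow>
     left_ideal M R \<and> M \<noteq> carrier R \<and>
     (\<forall>I. left_ideal I R \<longrightarrow> M \<subseteq> I \<longrightarrow> I = M \<or> I = carrier R)"

(* The library's ideals are two-sided; here the ring need not be commutative, so the
   Jacobson radical is the intersection of the maximal left ideals. *)
definition jacobson_radical :: "('a, 'b) ring_scheme \<Rightarrow> 'a set" where
  "jacobson_radical R = {x \<in> carrier R. \<forall>M. maximal_left_ideal M R \<longrightarrow> x \<in> M}"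

(* This is only a subset of R; in general it is not an ideal. *)
definition sqrt_jacobson :: "('a, 'b) ring_scheme \<Rightarrow> 'a set" where
  "sqrt_jacobson R =
     {z \<in> carrier R. \<exists>n::nat. n \<ge> 1 \<and> z [^]\<^bsub>R\<^esub> n \<in> jacobson_radical R}"

definition uniquely_sqrtJ_clean :: "('a, 'b) ring_scheme \<Rightarrow> bool" where
  "uniquely_sqrtJ_clean R \<longleftrightarrow>
     (\<forall>a \<in> carrier R.
        \<exists>!(e, z). e \<in> idempotents R \<and> z \<in> sqrt_jacobson R \<and> a = e \<oplus>\<^bsub>R\<^esub> z)"

definition ring_center :: "('a, 'b) ring_scheme \<Rightarrow> 'a set" where
  "ring_center R = {c \<in> carrier R. \<forall>r \<in> carrier R. c \<otimes>\<^bsub>R\<^esub> r = r \<otimes>\<^bsub>R\<^esub> c}"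

end

theory Submission
  imports Defs "HOL-Algebra.Multiplicative_Group"
begin

text \<open>
  Uniqueness of the decomposition says that an idempotent cannot be moved by a nonzero element
  of \<open>sqrt_jacobson R\<close> and stay idempotent: if \<open>e\<close> and \<open>e + x\<close> are both idempotent and \<open>x\<close> lies
  in \<open>sqrt_jacobson R\<close>, then \<open>(e + x) + 0 = e + x\<close> exhibits two decompositions of one element,
  whence \<open>x = 0\<close>.  The off-diagonal Peirce components of any \<open>r\<close> with respect to \<open>e\<close>, namely
  \<open>e r (1 - e)\<close> and \<open>(1 - e) r e\<close>, are such perturbations: each has square zero and keeps \<open>e\<close>
  idempotent when added to it.  Both therefore vanish, so \<open>e r = e r e = r e\<close>.
\<close>

lemma (in ring) zero_in_jacobson_radical: "\<zero> \<in> jacobson_radical R"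
  unfolding jacobson_radical_def maximal_left_ideal_def left_ideal_def
  by (auto intro: additive_subgroup.zero_closed)

lemma (in ring) square_zero_in_sqrt_jacobson:
  assumes "x \<in> carrier R" "x \<otimes> x = \<zero>"
  shows "x \<in> sqrt_jacobson R"
proof -
  have "x [^] (2::nat) \<in> jacobson_radical R"
    using assms zero_in_jacobson_radical by (simp add: numeral_2_eq_2)
  then show ?thesis
    using assms(1) by (auto simp: sqrt_jacobson_def intro!: exI[of _ "2::nat"])
qed

text \<open>
  The condition on \<open>e x + x e\<close> is what \<open>(e + x)(e + x) = e + x\<close> amounts to when \<open>x x = 0\<close>; in this
  form it covers the components \<open>e R (1 - e)\<close> and \<open>(1 - e) R e\<close> alike.
\<close>

lemma (in ring) square_zero_perturbation_trivial:
  assumes clean: "uniquely_sqrtJ_clean R"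
    and e: "e \<in> idempotents R"
    and x: "x \<in> carrier R" "x \<otimes> x = \<zero>" "e \<otimes> x \<oplus> x \<otimes> e = x"
  shows "x = \<zero>"
proof -
  have eR: "e \<in> carrier R" and ee: "e \<otimes> e = e"
    using e by (auto simp: idempotents_def)
  have "(e \<oplus> x) \<otimes> (e \<oplus> x) = e \<otimes> e \<oplus> (e \<otimes> x \<oplus> x \<otimes> e) \<oplus> x \<otimes> x"
    using eR x(1) by (simp add: l_distr r_distr a_ac)
  then have ex: "e \<oplus> x \<in> idempotents R"
    using eR ee x by (simp add: idempotents_def)
  let ?D = "\<lambda>(f, z). f \<in> idempotents R \<and> z \<in> sqrt_jacobson R \<and> e \<oplus> x = f \<oplus> z"
  have "\<exists>!p. ?D p"
    using clean a_closed[OF eR x(1)] unfolding uniquely_sqrtJ_clean_def by (rule bspec)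
  then have "\<exists>\<^sub>\<le>\<^sub>1p. ?D p"
    unfolding ex1_iff_ex_Uniq by (rule conjunct2)
  moreover have "?D (e, x)"
    using e x by (simp add: square_zero_in_sqrt_jacobson)
  moreover have "?D (e \<oplus> x, \<zero>)"
    using ex eR x(1) by (simp add: square_zero_in_sqrt_jacobson)
  ultimately have "(e, x) = (e \<oplus> x, \<zero>)"
    by (rule Uniq_D)
  then show ?thesis by simp
qed

theorem lemma4p1:
  fixes R (structure)
  assumes "ring R"
    and "\<one> \<noteq> \<zero>"
    and "uniquely_sqrtJ_clean R"
  shows "\<forall>e \<in> idempotents R. e \<in> ring_center R"
proof
  interpret ring R by fact
  fix e assume e: "e \<in> idempotents R"
  then have eR: "e \<in> carrier R" and ee: "e \<otimes> e = e"
    by (auto simp: idempotents_def)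
  have "e \<otimes> r = r \<otimes> e" if r: "r \<in> carrier R" for r
  proof -
    define f where "f = \<one> \<ominus> e"
    have fR: "f \<in> carrier R" and ef: "e \<otimes> f = \<zero>" and fe: "f \<otimes> e = \<zero>"
      using eR ee by (simp_all add: f_def minus_eq l_distr r_distr l_minus r_minus r_neg)
    have "e \<otimes> r \<otimes> f = \<zero>"
    proof (rule square_zero_perturbation_trivial[OF assms(3) e])
      let ?x = "e \<otimes> r \<otimes> f"
      show xR: "?x \<in> carrier R" using eR r fR by simp
      have ex: "e \<otimes> ?x = ?x" using eR r fR ee by (simp add: m_assoc[symmetric])
      have xe: "?x \<otimes> e = \<zero>" using eR r fR fe by (simp add: m_assoc)
      show "e \<otimes> ?x \<oplus> ?x \<otimes> e = ?x" using xR by (simp add: ex xe)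
      show "?x \<otimes> ?x = \<zero>" using m_assoc[OF xR eR xR] xR by (simp add: ex xe)
    qed
    moreover have "f \<otimes> r \<otimes> e = \<zero>"
    proof (rule square_zero_perturbation_trivial[OF assms(3) e])
      let ?x = "f \<otimes> r \<otimes> e"
      show xR: "?x \<in> carrier R" using eR r fR by simp
      have ex: "e \<otimes> ?x = \<zero>" using eR r fR ef by (simp add: m_assoc[symmetric])
      have xe: "?x \<otimes> e = ?x" using eR r fR ee by (simp add: m_assoc)
      show "e \<otimes> ?x \<oplus> ?x \<otimes> e = ?x" using xR by (simp add: ex xe)
      show "?x \<otimes> ?x = \<zero>" using m_assoc[OF xR eR xR] xR by (simp add: ex xe)
    qed
    moreover have "e \<otimes> r \<otimes> f = e \<otimes> r \<ominus> e \<otimes> r \<otimes> e" "f \<otimes> r \<otimes> e = r \<otimes> e \<ominus> e \<otimes> r \<otimes> e"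
      using eR r by (simp_all add: f_def minus_eq l_distr r_distr l_minus r_minus)
    ultimately have "e \<otimes> r = e \<otimes> r \<otimes> e" "r \<otimes> e = e \<otimes> r \<otimes> e"
      using eR r by simp_all
    then show ?thesis by simp
  qed
  with eR show "e \<in> ring_center R"
    by (simp add: ring_center_def)
qed

end
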